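(* Let $R$ be a commutative ring and let $n\in\mathbb{N}$. Every $1$-nullcyclic $n\times n$-matrix over $R$ is $1$-principled.
   Context: All rings are commutative, associative and unital; $\mathbb{N}=\{0,1,2,\ldots\}$ and $[n]:=\{1,2,\ldots,n\}$. Let $A=(a_{i,j})_{i,j\in[n]}$ be a matrix over $R$. For $S\subseteq[n]$, $A_S$ denotes the principal submatrix of $A$ with row and column set $S$; the empty determinant is $1$. $A$ is $1$-principled if $\det A_S=1$ for every $S\subseteq[n]$. A cycle on $[n]$ is a $k$-tuple $C=(i_1,i_2,\ldots,i_k)$ with $k>0$ and $i_1,\ldots,i_k$ distinct elements of $[n]$, considered up to cyclic rotation; it is nontrivial if $k>1$. The $A$-weight of a cycle $C=(i_1,\ldots,i_k)$ is $w_A(C):=a_{i_1,i_2}a_{i_2,i_3}\cdots a_{i_{k-1},i_k}a_{i_k,i_1}$. $A$ is nullcyclic if $w_A(C)=0$ for each nontrivial cycle $C$ on $[n]$; it is $1$-diagonal if all its diagonal entries equal $1$; it is $1$-nullcyclic if it is both $1$-diagonal and nullcyclic. *)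

theory Defs
  imports Jordan_Normal_Form.Determinant Jordan_Normal_Form.DL_Submatrix
begin

(* Commutative unital rings are types of sort {comm_ring,comm_monoid_mult}. The class comm_ring_1
   would add the axiom 0 \<noteq> 1 and so exclude the zero ring. Rows and columns are numbered 0, ..., n-1
   instead of 1, ..., n. *)

(* The Leibniz formula of the library constant det, which requires sort comm_ring_1; ring_det_eq_det
   shows that the two coincide there. In particular the empty determinant is 1. *)
definition ring_det :: "'a::{comm_ring,comm_monoid_mult} mat \<Rightarrow> 'a" where
  "ring_det A = (if dim_row A = dim_col A then
     (\<Sum>p | p permutes {0..<dim_row A}.
        if evenperm p then (\<Prod>i = 0..<dim_row A. A $$ (i, p i))
        else - (\<Prod>i = 0..<dim_row A. A $$ (i, p i)))
   else 0)"

lemma ring_det_eq_det: "ring_det A = det A"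
  unfolding ring_det_def det_def
  by (auto intro!: sum.cong simp: sign_def)

lemma ring_det_empty: "A \<in> carrier_mat 0 0 \<Longrightarrow> ring_det A = 1"
  by (simp add: ring_det_def evenperm_id[unfolded id_def])

definition one_principled :: "'a::{comm_ring,comm_monoid_mult} mat \<Rightarrow> bool" where
  "one_principled A \<longleftrightarrow> (\<forall>S. S \<subseteq> {0..<dim_row A} \<longrightarrow> ring_det (submatrix A S S) = 1)"

(* A cycle is represented by any of the tuples in its class modulo rotation; by the two rotation
   lemmas below, the notions used here do not depend on the representative. *)
definition is_cycle :: "nat \<Rightarrow> nat list \<Rightarrow> bool" where
  "is_cycle n C \<longleftrightarrow> C \<noteq> [] \<and> distinct C \<and> set C \<subseteq> {0..<n}"

definition nontrivial_cycle :: "nat \<Rightarrow> nat list \<Rightarrow> bool" where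
  "nontrivial_cycle n C \<longleftrightarrow> is_cycle n C \<and> length C > 1"

definition cycle_weight :: "'a::comm_monoid_mult mat \<Rightarrow> nat list \<Rightarrow> 'a" where
  "cycle_weight A C = (\<Prod>j = 0..<length C. A $$ (C ! j, C ! (Suc j mod length C)))"

lemma nontrivial_cycle_rotate: "nontrivial_cycle n (rotate m C) = nontrivial_cycle n C"
  by (simp add: nontrivial_cycle_def is_cycle_def)

lemma cycle_weight_rotate: "cycle_weight A (rotate m C) = cycle_weight A C"
proof -
  have "cycle_weight A (rotate1 D) = cycle_weight A D" for D
  proof (cases D)
    case (Cons x xs)
    define k where "k = length D"
    have k: "k > 0" using Cons by (simp add: k_def)
    let ?f = "\<lambda>j. A $$ (D ! j, D ! (Suc j mod k))"
    have "cycle_weight A (rotate1 D) = (\<Prod>j = 0..<k. ?f (Suc j mod k))"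
      unfolding cycle_weight_def
      using k by (intro prod.cong) (auto simp: nth_rotate1 k_def)
    also have "\<dots> = (\<Prod>j = 0..<k. ?f j)"
    proof (rule prod.reindex_bij_witness[where i = "\<lambda>j. (j + (k - 1)) mod k" and j = "\<lambda>j. Suc j mod k"])
      fix a assume "a \<in> {0..<k}"
      then show "(Suc a mod k + (k - 1)) mod k = a"
        using k by (cases "Suc a = k") auto
    next
      fix b assume "b \<in> {0..<k}"
      then show "Suc ((b + (k - 1)) mod k) mod k = b"
        using k by (simp add: mod_Suc_eq)
    qed (use k in auto)
    finally show ?thesis by (simp add: cycle_weight_def k_def)
  qed simp
  then show ?thesis
    by (induction m) (simp_all add: rotate_Suc)
qed

definition nullcyclic :: "'a::{comm_ring,comm_monoid_mult} mat \<Rightarrow> bool" where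
  "nullcyclic A \<longleftrightarrow> (\<forall>C. nontrivial_cycle (dim_row A) C \<longrightarrow> cycle_weight A C = 0)"

definition one_diagonal :: "'a::{comm_ring,comm_monoid_mult} mat \<Rightarrow> bool" where
  "one_diagonal A \<longleftrightarrow> (\<forall>i < dim_row A. A $$ (i, i) = 1)"

definition one_nullcyclic :: "'a::{comm_ring,comm_monoid_mult} mat \<Rightarrow> bool" where
  "one_nullcyclic A \<longleftrightarrow> one_diagonal A \<and> nullcyclic A"

end

theory Submission
  imports Defs "HOL-Combinatorics.Cycles"
begin

text \<open>
  A permutation \<open>p\<close> other than the identity moves some index \<open>x\<close>, and the orbit of \<open>x\<close> under \<open>p\<close>,
  listed as \<open>x, p x, p (p x), \<dots>\<close>, is a nontrivial cycle. The factors of the Leibniz term of \<open>p\<close>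
  that belong to this orbit multiply up to the weight of that cycle, so in a nullcyclic matrix the
  whole term vanishes (\<open>nullcyclic_leibniz_term_eq_0\<close>). Only the term of the identity survives, which
  is the product of the diagonal entries; hence the determinant of a 1-nullcyclic matrix is 1
  (\<open>ring_det_one_nullcyclic\<close>).

  This covers all principal minors at once, because being 1-nullcyclic passes to principal
  submatrices: a cycle of a principal submatrix, renumbered by the order embedding of its index set,
  is a cycle of the full matrix with the same weight (\<open>one_nullcyclic_submatrix\<close>).
\<close>

text \<open>
  Applying \<open>p\<close> to the \<open>j\<close>-th entry of the orbit gives the next one, and the last entry is sent back
  to \<open>x\<close>; so the factors \<open>(i, p i)\<close> over the orbit are exactly those of the cycle weight.
\<close>
lemma cycle_weight_orbit:
  assumes "permutation p"
  shows "cycle_weight A (support p x) = (\<Prod>i\<in>set (support p x). A $$ (i, p i))"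
proof -
  define k where "k = least_power p x"
  have k: "k > 0" "(p ^^ k) x = x"
    using least_power_of_permutation[OF assms] by (simp_all add: k_def)
  have "(p ^^ (Suc j mod k)) x = p ((p ^^ j) x)" if "j < k" for j
    using that k by (cases "Suc j = k") auto
  then have "cycle_weight A (support p x) = (\<Prod>j = 0..<k. A $$ ((p ^^ j) x, p ((p ^^ j) x)))"
    unfolding cycle_weight_def using k(1)
    by (intro prod.cong) (simp_all add: k_def[symmetric])
  also have "\<dots> = (\<Prod>i\<in>(\<lambda>j. (p ^^ j) x) ` {0..<k}. A $$ (i, p i))"
    using cycle_of_permutation[OF assms, of x]
    by (subst prod.reindex) (simp_all add: distinct_map k_def[symmetric])
  finally show ?thesis by (simp add: k_def)
qed

lemma nontrivial_cycle_orbit: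
  assumes "p permutes {0..<n}" and "p x \<noteq> x"
  shows "nontrivial_cycle n (support p x)"
proof -
  have p: "permutation p" using assms(1) by (rule permutes_imp_permutation[rotated]) simp
  have x: "x \<in> {0..<n}" using assms by (meson permutes_def)
  have "(p ^^ j) x \<in> {0..<n}" for j
    using permutes_in_image[OF permutes_funpow[OF assms(1)]] x by blast
  then have "set (support p x) \<subseteq> {0..<n}" by (auto simp del: atLeastLessThan_iff)
  moreover have "length (support p x) > 1" using least_power_gt_one[OF p assms(2)] by simp
  ultimately show ?thesis
    using cycle_of_permutation[OF p, of x]
    unfolding nontrivial_cycle_def is_cycle_def by fastforce
qed

lemma nullcyclic_leibniz_term_eq_0:
  fixes A :: "'a::{comm_ring,comm_monoid_mult} mat"
  assumes "nullcyclic A" and p: "p permutes {0..<dim_row A}" and "p \<noteq> id"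
  shows "(\<Prod>i = 0..<dim_row A. A $$ (i, p i)) = 0"
proof -
  obtain x where "p x \<noteq> x" using \<open>p \<noteq> id\<close> by (auto simp: fun_eq_iff)
  let ?C = "support p x"
  have C: "nontrivial_cycle (dim_row A) ?C"
    by (rule nontrivial_cycle_orbit) fact+
  have perm: "permutation p" using p by (rule permutes_imp_permutation[rotated]) simp
  have "(\<Prod>i\<in>set ?C. A $$ (i, p i)) = cycle_weight A ?C"
    by (rule cycle_weight_orbit[OF perm, symmetric])
  also have "\<dots> = 0" using C assms(1) unfolding nullcyclic_def by blast
  finally have orbit: "(\<Prod>i\<in>set ?C. A $$ (i, p i)) = 0" .
  have "set ?C \<subseteq> {0..<dim_row A}"
    using C unfolding nontrivial_cycle_def is_cycle_def by blast
  then have "(\<Prod>i = 0..<dim_row A. A $$ (i, p i)) =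
      (\<Prod>i\<in>{0..<dim_row A} - set ?C. A $$ (i, p i)) * (\<Prod>i\<in>set ?C. A $$ (i, p i))"
    by (rule prod.subset_diff) simp
  then show ?thesis by (simp only: orbit mult_zero_right)
qed

lemma ring_det_one_nullcyclic:
  fixes A :: "'a::{comm_ring,comm_monoid_mult} mat"
  assumes "one_nullcyclic A" and "dim_row A = dim_col A"
  shows "ring_det A = 1"
proof -
  let ?N = "{0..<dim_row A}"
  let ?t = "\<lambda>p. \<Prod>i\<in>?N. A $$ (i, p i)"
  let ?s = "\<lambda>p. if evenperm p then ?t p else - ?t p"
  have zero: "?s p = 0" if "p permutes ?N" "p \<noteq> id" for p
    using nullcyclic_leibniz_term_eq_0[OF _ that] assms(1) by (simp add: one_nullcyclic_def)
  have "ring_det A = sum ?s {p. p permutes ?N}"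
    using assms(2) by (simp add: ring_det_def)
  also have "\<dots> = sum ?s {id}"
    by (rule sum.mono_neutral_right) (auto simp: finite_permutations permutes_id zero simp del: id_apply)
  also have "\<dots> = ?t id" by (simp add: evenperm_id)
  also have "\<dots> = 1"
    using assms(1) by (simp add: one_nullcyclic_def one_diagonal_def)
  finally show ?thesis .
qed

lemma inj_on_pick: "inj_on (pick S) {0..<card {a. a < n \<and> a \<in> S}}"
proof (rule linorder_inj_onI)
  fix i j assume "i < j" and "j \<in> {0..<card {a. a < n \<and> a \<in> S}}"
  moreover have "card {a. a < n \<and> a \<in> S} \<le> card S" if "finite S"
    using that by (intro card_mono) auto
  ultimately have "j < card S \<or> infinite S" by fastforce
  then have "pick S i < pick S j" using \<open>i < j\<close> by (rule pick_mono)
  then show "pick S i \<noteq> pick S j" by simp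
qed auto

lemma one_nullcyclic_submatrix:
  fixes A :: "'a::{comm_ring,comm_monoid_mult} mat"
  assumes A: "one_nullcyclic A" and sq: "dim_row A = dim_col A"
  shows "one_nullcyclic (submatrix A S S)"
proof -
  let ?B = "submatrix A S S"
  let ?m = "card {i. i < dim_row A \<and> i \<in> S}"
  have entry: "?B $$ (i, j) = A $$ (pick S i, pick S j)" if "i < ?m" "j < ?m" for i j
    using that sq by (intro submatrix_index) simp_all
  have "one_diagonal ?B"
    using A by (auto simp: one_nullcyclic_def one_diagonal_def dim_submatrix entry pick_le)
  moreover have "cycle_weight ?B C = 0" if C: "nontrivial_cycle ?m C" for C
  proof -
    have sub: "set C \<subseteq> {0..<?m}" and "distinct C"
      using C by (auto simp: nontrivial_cycle_def is_cycle_def)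
    then have "distinct (map (pick S) C)"
      using inj_on_subset[OF inj_on_pick sub] by (simp add: distinct_map)
    moreover have "pick S i < dim_row A" if "i \<in> set C" for i
      using sub that by (intro pick_le) auto
    ultimately have "nontrivial_cycle (dim_row A) (map (pick S) C)"
      using C unfolding nontrivial_cycle_def is_cycle_def by (simp add: image_subset_iff)
    then have "cycle_weight A (map (pick S) C) = 0"
      using A unfolding one_nullcyclic_def nullcyclic_def by blast
    moreover have "cycle_weight ?B C = cycle_weight A (map (pick S) C)"
      unfolding cycle_weight_def
    proof (rule prod.cong)
      fix j assume "j \<in> {0..<length (map (pick S) C)}"
      then have j: "j < length C" "Suc j mod length C < length C"
        by (auto intro: mod_less_divisor)
      then have "C ! j < ?m" "C ! (Suc j mod length C) < ?m"
        using sub by (metis atLeastLessThan_iff nth_mem subsetD)+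
      then show "?B $$ (C ! j, C ! (Suc j mod length C)) =
          A $$ (map (pick S) C ! j, map (pick S) C ! (Suc j mod length (map (pick S) C)))"
        using j by (simp add: entry)
    qed simp
    ultimately show ?thesis by simp
  qed
  ultimately show ?thesis
    by (simp add: one_nullcyclic_def nullcyclic_def dim_submatrix)
qed

theorem proposition3p1:
  fixes A :: "'a::{comm_ring,comm_monoid_mult} mat" and n :: nat
  assumes "A \<in> carrier_mat n n"
    and "one_nullcyclic A"
  shows "one_principled A"
  using assms
  by (auto simp: one_principled_def dim_submatrix
      intro!: ring_det_one_nullcyclic one_nullcyclic_submatrix)

end
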